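(* Let $\gamma:t\mapsto\gamma(t)$ be a smooth curve in $\mathbb R^n$ with nowhere vanishing velocity, and let $U$ and $A$ be its velocity and acceleration vector fields. Let $V$ be a conformal Killing vector field restricted to $\gamma$. Then the function $$F=\frac{d}{dt}\langle W,V'\rangle+\langle W',V'\rangle-\langle C,V\rangle,\qquad W=u^{-2}U,$$ where $'$ denotes $\frac{d}{dt}$ and $$C=u^{-2}\Big(A'-u^{-2}|A|^2U-2u^{-2}\langle A,U\rangle A+4u^{-4}\langle A,U\rangle^2U-2u^{-2}\langle A',U\rangle U\Big),$$ is constant on any such curve $\gamma$ that satisfies the conformal Mercator equation $\frac{dC}{dt}=0$.
   Context: The conformal sphere is described in flat coordinates $\mathbb R^n$ with the Euclidean metric $\delta$ in the conformal class; $\langle\cdot,\cdot\rangle$ is the Euclidean scalar product, $u=\sqrt{\langle U,U\rangle}$, and $A'=dA/dt$. The conformal Mercator equation is the ODE $dC/dt=0$ for parametrized curves. Conformal Killing vector fields are the infinitesimal conformal transformations of the conformal sphere, forming the Lie algebra $\mathfrak{so}(n+1,1)$; in the coordinates $(x^i)$ they are the vector fields $$\big(T^i+{R_j}^ix^j+a\,x^i+x_jx^jS^i-2S_jx^jx^i\big)\frac{\partial}{\partial x^i}$$ with constant $T^i$, $a$, $S^i$, ${R_j}^i$, where $R_{ij}=-R_{ji}$ (indices raised and lowered by $\delta$, repeated indices summed). They satisfy $\nabla_{(i}V_{j)}=\lambda\delta_{ij}$ with $\lambda=\frac1n\nabla_iV^i$. *)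

theory Defs
  imports "HOL-Analysis.Analysis"
begin

definition ddt :: "(real \<Rightarrow> 'a::real_normed_vector) \<Rightarrow> real \<Rightarrow> 'a"
  where "ddt f t = vector_derivative f (at t)"

(* For open I this is C-infinity smoothness: every iterated derivative exists on I,
   so that each of them is continuous there. *)
definition smooth_curve_on :: "real set \<Rightarrow> (real \<Rightarrow> 'a::real_normed_vector) \<Rightarrow> bool"
  where "smooth_curve_on I \<gamma> \<longleftrightarrow> (\<forall>k. \<forall>t\<in>I. ((ddt ^^ k) \<gamma>) differentiable (at t))"

(* The matrix entry R $ j $ i is the coefficient R_j^i, so (x v* R) $ i is the sum over j
   of R_j^i x^j.  In dimensions 1 and 2 the local equation for conformal Killing fields of
   R^n has further solutions; the fields below are, in every dimension, those of so(n+1,1). *)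
definition conformal_killing :: "(real^'n \<Rightarrow> real^'n) \<Rightarrow> bool"
  where "conformal_killing V \<longleftrightarrow>
    (\<exists>(T :: real^'n) (R :: real^'n^'n) (a :: real) (S :: real^'n).
      (\<forall>i j. R $ i $ j = - R $ j $ i) \<and>
      (\<forall>x. V x = T + x v* R + a *\<^sub>R x + (x \<bullet> x) *\<^sub>R S - (2 * (S \<bullet> x)) *\<^sub>R x))"

definition velocity :: "(real \<Rightarrow> real^'n) \<Rightarrow> real \<Rightarrow> real^'n"
  where "velocity \<gamma> = ddt \<gamma>"

definition acceleration :: "(real \<Rightarrow> real^'n) \<Rightarrow> real \<Rightarrow> real^'n"
  where "acceleration \<gamma> = ddt (velocity \<gamma>)"

definition speed :: "(real \<Rightarrow> real^'n) \<Rightarrow> real \<Rightarrow> real"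
  where "speed \<gamma> t = sqrt (velocity \<gamma> t \<bullet> velocity \<gamma> t)"

definition mercator_W :: "(real \<Rightarrow> real^'n) \<Rightarrow> real \<Rightarrow> real^'n"
  where "mercator_W \<gamma> t = (1 / speed \<gamma> t ^ 2) *\<^sub>R velocity \<gamma> t"

definition mercator_C :: "(real \<Rightarrow> real^'n) \<Rightarrow> real \<Rightarrow> real^'n"
  where "mercator_C \<gamma> t =
    (let U = velocity \<gamma> t; A = acceleration \<gamma> t; A' = ddt (acceleration \<gamma>) t; u = speed \<gamma> t in
      (1 / u ^ 2) *\<^sub>R
        (A' - ((norm A)\<^sup>2 / u ^ 2) *\<^sub>R U
            - (2 * (A \<bullet> U) / u ^ 2) *\<^sub>R A
            + (4 * (A \<bullet> U)\<^sup>2 / u ^ 4) *\<^sub>R U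
            - (2 * (A' \<bullet> U) / u ^ 2) *\<^sub>R U))"

definition conformal_mercator_on :: "real set \<Rightarrow> (real \<Rightarrow> real^'n) \<Rightarrow> bool"
  where "conformal_mercator_on I \<gamma> \<longleftrightarrow>
    (\<forall>t\<in>I. (mercator_C \<gamma> has_vector_derivative 0) (at t))"

definition mercator_F ::
    "(real^'n \<Rightarrow> real^'n) \<Rightarrow> (real \<Rightarrow> real^'n) \<Rightarrow> real \<Rightarrow> real"
  where "mercator_F V \<gamma> t =
    (let W = mercator_W \<gamma>; v = V \<circ> \<gamma> in
      ddt (\<lambda>s. W s \<bullet> ddt v s) t + ddt W t \<bullet> ddt v t - mercator_C \<gamma> t \<bullet> v t)"

end

theory Submission
  imports Defs
begin

text \<open>
  Along the curve, \<open>V' = L U\<close>, \<open>V'' = L A + B(U,U)\<close> and \<open>V''' = L A' + 3 B(U,A)\<close>, where \<open>L\<close> is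
  the differential of \<open>V\<close> and \<open>B\<close> its (constant) second differential. Since \<open>C' = 0\<close>,
  \<open>F' = \<langle>2W'' - C, V'\<rangle> + 3\<langle>W', V''\<rangle> + \<langle>W, V'''\<rangle>\<close>. This vanishes for every \<open>V\<close> because \<open>L\<close> is
  skew up to a multiple of the identity, and because the two contributions of \<open>B\<close> are
  \<open>\<langle>W', B(U,U)\<rangle> = 2\<langle>S, A\<rangle> = -\<langle>W, B(U,A)\<rangle>\<close>.
\<close>

section \<open>Differentiation rules for vector-valued functions\<close>

lemma has_vector_derivative_inner:
  fixes f g :: "real \<Rightarrow> 'a::real_inner"
  assumes "(f has_vector_derivative f') (at t within S)"
    and "(g has_vector_derivative g') (at t within S)"
  shows "((\<lambda>s. f s \<bullet> g s) has_vector_derivative (f t \<bullet> g' + f' \<bullet> g t)) (at t within S)"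
  using bounded_bilinear.has_vector_derivative[OF bounded_bilinear_inner assms] .

lemma has_vector_derivative_scaleR_vec:
  fixes f :: "real \<Rightarrow> real" and g :: "real \<Rightarrow> 'a::real_normed_vector"
  assumes "(f has_vector_derivative f') (at t within S)"
    and "(g has_vector_derivative g') (at t within S)"
  shows "((\<lambda>s. f s *\<^sub>R g s) has_vector_derivative (f t *\<^sub>R g' + f' *\<^sub>R g t)) (at t within S)"
  using bounded_bilinear.has_vector_derivative[OF bounded_bilinear_scaleR assms] .

lemma has_vector_derivative_vector_matrix_mult:
  fixes R :: "real^'n^'m"
  assumes "(f has_vector_derivative f') (at t within S)"
  shows "((\<lambda>s. f s v* R) has_vector_derivative (f' v* R)) (at t within S)"
proof -
  have "bounded_linear (\<lambda>x :: real^'m. x v* R)"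
    using matrix_vector_mul_bounded_linear[of "transpose R"]
    by (simp only: transpose_matrix_vector[symmetric])
  from bounded_linear.has_vector_derivative[OF this assms] show ?thesis .
qed

lemma ddt_eqI: "(f has_vector_derivative f') (at t) \<Longrightarrow> ddt f t = f'"
  by (simp add: ddt_def vector_derivative_at)

text \<open>A derivative depends only on values near the point. This allows differentiating an
  expression that contains another \<open>ddt\<close>, whose value is known on \<open>I\<close>
  only.\<close>

lemma ddt_eq_on_open:
  assumes "open I" "t \<in> I" "\<And>s. s \<in> I \<Longrightarrow> f s = g s"
    and "(g has_vector_derivative g') (at t)"
  shows "ddt f t = g'"
  using assms has_vector_derivative_transform_within_open[of g g' t I f] by (auto intro: ddt_eqI)

section \<open>Conformal Killing fields and their differentials\<close>

definition conformal_field ::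
    "real^'n \<Rightarrow> real^'n^'n \<Rightarrow> real \<Rightarrow> real^'n \<Rightarrow> real^'n \<Rightarrow> real^'n" where
  "conformal_field T R a S x = T + x v* R + a *\<^sub>R x + (x \<bullet> x) *\<^sub>R S - (2 * (S \<bullet> x)) *\<^sub>R x"

text \<open>The differential of \<open>conformal_field T R a S\<close> at the point \<open>x\<close>
  in the direction \<open>y\<close>.\<close>

definition conformal_diff ::
    "real^'n^'n \<Rightarrow> real \<Rightarrow> real^'n \<Rightarrow> real^'n \<Rightarrow> real^'n \<Rightarrow> real^'n" where
  "conformal_diff R a S x y = y v* R + a *\<^sub>R y + (2 * (x \<bullet> y)) *\<^sub>R S
     - (2 * (S \<bullet> y)) *\<^sub>R x - (2 * (S \<bullet> x)) *\<^sub>R y"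

text \<open>The second differential of the field, free of the base point because the field is a
  quadratic polynomial.\<close>

definition conformal_diff2 :: "real^'n \<Rightarrow> real^'n \<Rightarrow> real^'n \<Rightarrow> real^'n" where
  "conformal_diff2 S y z = (2 * (y \<bullet> z)) *\<^sub>R S - (2 * (S \<bullet> z)) *\<^sub>R y - (2 * (S \<bullet> y)) *\<^sub>R z"

lemma conformal_diff2_commute: "conformal_diff2 S y z = conformal_diff2 S z y"
  by (simp add: conformal_diff2_def inner_commute algebra_simps)

lemma has_vector_derivative_conformal_field:
  assumes "(x has_vector_derivative x') (at t)"
  shows "((\<lambda>s. conformal_field T R a S (x s)) has_vector_derivative
           conformal_diff R a S (x t) x') (at t)"
  unfolding conformal_field_def
  by (rule has_vector_derivative_eq_rhs,
      (rule assms has_vector_derivative_add has_vector_derivative_diff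
        has_vector_derivative_scaleR_vec has_vector_derivative_mult_right
        has_vector_derivative_inner has_vector_derivative_vector_matrix_mult
        has_vector_derivative_const)+)
    (simp add: conformal_diff_def inner_commute algebra_simps)

text \<open>The part of \<open>conformal_diff R a S x y\<close> that depends on \<open>x\<close> is
  exactly \<open>conformal_diff2 S x y\<close>, so moving the base point contributes the second
  summand.\<close>

lemma has_vector_derivative_conformal_diff:
  assumes "(x has_vector_derivative x') (at t)" "(y has_vector_derivative y') (at t)"
  shows "((\<lambda>s. conformal_diff R a S (x s) (y s)) has_vector_derivative
           conformal_diff R a S (x t) y' + conformal_diff2 S x' (y t)) (at t)"
  unfolding conformal_diff_def
  by (rule has_vector_derivative_eq_rhs,
      (rule assms has_vector_derivative_add has_vector_derivative_diff
        has_vector_derivative_scaleR_vec has_vector_derivative_mult_right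
        has_vector_derivative_inner has_vector_derivative_vector_matrix_mult
        has_vector_derivative_const)+)
    (simp add: conformal_diff2_def inner_commute algebra_simps)

lemma has_vector_derivative_conformal_diff2:
  assumes "(y has_vector_derivative y') (at t)" "(z has_vector_derivative z') (at t)"
  shows "((\<lambda>s. conformal_diff2 S (y s) (z s)) has_vector_derivative
           conformal_diff2 S y' (z t) + conformal_diff2 S (y t) z') (at t)"
  unfolding conformal_diff2_def
  by (rule has_vector_derivative_eq_rhs,
      (rule assms has_vector_derivative_add has_vector_derivative_diff
        has_vector_derivative_scaleR_vec has_vector_derivative_mult_right
        has_vector_derivative_inner has_vector_derivative_vector_matrix_mult
        has_vector_derivative_const)+)
    (simp add: inner_commute algebra_simps)

lemma skew_inner_vector_matrix_mult:
  fixes R :: "real^'n^'n"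
  assumes "\<And>i j. R $ i $ j = - R $ j $ i"
  shows "y \<bullet> (z v* R) = - (z \<bullet> (y v* R))"
proof -
  have "transpose R = - R"
    by (auto simp: vec_eq_iff transpose_def intro: assms)
  then have "z v* R = (- R) *v z"
    by (metis transpose_matrix_vector)
  then have "z v* R = - (R *v z)"
    by (simp add: vec_eq_iff matrix_vector_mult_def sum_negf)
  then show ?thesis
    by (simp add: dot_lmul_matrix inner_commute[of z "y v* R"])
qed

text \<open>This is the conformal Killing equation with factor
  \<open>a - 2 * (S \<bullet> x)\<close>. The \<open>R\<close> terms cancel by skewness, and the
  terms \<open>(2 * (x \<bullet> y)) *\<^sub>R S\<close> and
  \<open>(2 * (S \<bullet> y)) *\<^sub>R x\<close> form another skew map; multiples of
  \<open>y\<close> remain.\<close>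

lemma conformal_diff_symmetric_part:
  assumes "\<And>i j. R $ i $ j = - R $ j $ i"
  shows "y \<bullet> conformal_diff R a S x z + z \<bullet> conformal_diff R a S x y
           = 2 * (a - 2 * (S \<bullet> x)) * (y \<bullet> z)"
  using skew_inner_vector_matrix_mult[OF assms, of y z]
  by (simp add: conformal_diff_def inner_simps inner_commute algebra_simps)

section \<open>The factor u^(-2) and its derivatives along the curve\<close>

definition inv_sq :: "'a::real_inner \<Rightarrow> real" where
  "inv_sq U = inverse (U \<bullet> U)"

text \<open>\<open>inv_sq1\<close> and \<open>inv_sq2\<close> are the first two derivatives of
  u^(-2), written as algebraic expressions in the velocity and its derivatives so that the main
  identity can be stated without a curve.\<close>

definition inv_sq1 :: "'a::real_inner \<Rightarrow> 'a \<Rightarrow> real" where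
  "inv_sq1 U A = - 2 * (inv_sq U)\<^sup>2 * (A \<bullet> U)"

definition inv_sq2 :: "'a::real_inner \<Rightarrow> 'a \<Rightarrow> 'a \<Rightarrow> real" where
  "inv_sq2 U A A' = 8 * (inv_sq U)^3 * (A \<bullet> U)\<^sup>2 - 2 * (inv_sq U)\<^sup>2 * (A \<bullet> A + A' \<bullet> U)"

lemma has_vector_derivative_inv_sq:
  assumes "(U has_vector_derivative A) (at t)" "U t \<noteq> 0"
  shows "((\<lambda>s. inv_sq (U s)) has_vector_derivative inv_sq1 (U t) A) (at t)"
proof -
  have "((\<lambda>s. U s \<bullet> U s) has_real_derivative 2 * (A \<bullet> U t)) (at t)"
    using has_vector_derivative_inner[OF assms(1,1)]
    by (simp add: has_real_derivative_iff_has_vector_derivative inner_commute)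
  from DERIV_inverse_fun[OF this] assms(2) show ?thesis
    by (simp add: has_real_derivative_iff_has_vector_derivative inv_sq_def inv_sq1_def
        power2_eq_square algebra_simps)
qed

lemma has_vector_derivative_inv_sq1:
  assumes "(U has_vector_derivative A t) (at t)" "(A has_vector_derivative A') (at t)" "U t \<noteq> 0"
  shows "((\<lambda>s. inv_sq1 (U s) (A s)) has_vector_derivative inv_sq2 (U t) (A t) A') (at t)"
proof -
  note dq = has_vector_derivative_inv_sq[OF assms(1,3)]
  \<comment> \<open>The square is spelled out as a product so that the product rule applies.\<close>
  have "((\<lambda>s. - 2 * (inv_sq (U s) * inv_sq (U s) * (A s \<bullet> U s))) has_vector_derivative
      - 2 * (inv_sq (U t) * inv_sq (U t) * (A t \<bullet> A t + A' \<bullet> U t)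
        + (inv_sq (U t) * inv_sq1 (U t) (A t) + inv_sq1 (U t) (A t) * inv_sq (U t)) * (A t \<bullet> U t)))
      (at t)"
    by (intro has_vector_derivative_mult_right has_vector_derivative_mult
        has_vector_derivative_inner dq assms)
  then show ?thesis
    by (simp add: inv_sq1_def inv_sq2_def algebra_simps power2_eq_square power3_eq_cube)
qed

section \<open>The pointwise algebraic identity\<close>

text \<open>The vanishing of \<open>F'\<close> at one instant: the left side is
  \<open>2\<langle>W'',V'\<rangle> + 3\<langle>W',V''\<rangle> + \<langle>W,V'''\<rangle>\<close>
  and the right side is \<open>\<langle>C,V'\<rangle>\<close>. Here \<open>l\<close> is the
  conformal factor of \<open>V\<close> at the point.\<close>

lemma conformal_mercator_identity:
  fixes U A A' S :: "real^'n" and L :: "real^'n \<Rightarrow> real^'n"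
  defines "q \<equiv> inv_sq U" and "q1 \<equiv> inv_sq1 U A" and "q2 \<equiv> inv_sq2 U A A'"
  assumes sym: "\<And>y z. y \<bullet> L z + z \<bullet> L y = 2 * l * (y \<bullet> z)" and "U \<noteq> 0"
  shows "2 * ((q2 *\<^sub>R U + (2 * q1) *\<^sub>R A + q *\<^sub>R A') \<bullet> L U)
       + 3 * ((q1 *\<^sub>R U + q *\<^sub>R A) \<bullet> (L A + conformal_diff2 S U U))
       + (q *\<^sub>R U) \<bullet> (L A' + 3 *\<^sub>R conformal_diff2 S U A)
       = (q *\<^sub>R (A' - (q * (A \<bullet> A)) *\<^sub>R U - (2 * q * (A \<bullet> U)) *\<^sub>R A
            + (4 * q\<^sup>2 * (A \<bullet> U)\<^sup>2) *\<^sub>R U - (2 * q * (A' \<bullet> U)) *\<^sub>R U)) \<bullet> L U"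
proof -
  define p where "p = U \<bullet> U"
  \<comment> \<open>With this relation every division by u^2 becomes polynomial, as
    \<open>algebra\<close> requires.\<close>
  have pq: "p * q = 1"
    using \<open>U \<noteq> 0\<close> by (simp add: p_def q_def inv_sq_def)
  \<comment> \<open>By \<open>sym\<close>, all occurrences of \<open>L\<close> reduce to
    \<open>U \<bullet> L A\<close>, \<open>U \<bullet> L A'\<close> and multiples of
    \<open>l\<close>.\<close>
  have UL: "U \<bullet> L U = l * p" and AL: "A \<bullet> L A = l * (A \<bullet> A)"
    and AU: "A \<bullet> L U = 2 * l * (A \<bullet> U) - U \<bullet> L A"
    and A'U: "A' \<bullet> L U = 2 * l * (A' \<bullet> U) - U \<bullet> L A'"
    using sym[of U U] sym[of A A] sym[of A U] sym[of A' U] by (simp_all add: p_def)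
  have q1: "q1 = - 2 * q\<^sup>2 * (A \<bullet> U)"
    and q2: "q2 = 8 * q^3 * (A \<bullet> U)\<^sup>2 - 2 * q\<^sup>2 * (A \<bullet> A + A' \<bullet> U)"
    by (simp_all add: q1_def q2_def q_def inv_sq1_def inv_sq2_def)
  \<comment> \<open>The \<open>S \<bullet> U\<close> terms cancel because
    \<open>p * q1 = - 2 * q * (A \<bullet> U)\<close>. In the goal both this value and that of
    \<open>B2\<close> carry the factor 3, so together they vanish.\<close>
  have B1: "(q1 *\<^sub>R U + q *\<^sub>R A) \<bullet> conformal_diff2 S U U = 2 * (S \<bullet> A)"
  proof -
    have "(q1 *\<^sub>R U + q *\<^sub>R A) \<bullet> conformal_diff2 S U U
        = q1 * (2 * p * (S \<bullet> U) - 4 * (S \<bullet> U) * p) + q * (2 * p * (S \<bullet> A) - 4 * (S \<bullet> U) * (A \<bullet> U))"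
      by (simp only: conformal_diff2_def p_def inner_simps inner_commute[of _ S]) algebra
    then show ?thesis
      using pq unfolding q1 by algebra
  qed
  have B2: "(q *\<^sub>R U) \<bullet> conformal_diff2 S U A = - 2 * (S \<bullet> A)"
  proof -
    have "(q *\<^sub>R U) \<bullet> conformal_diff2 S U A = - 2 * (p * q) * (S \<bullet> A)"
      by (simp add: conformal_diff2_def p_def inner_simps inner_commute algebra_simps)
    then show ?thesis using pq by simp
  qed
  \<comment> \<open>What remains once the \<open>S\<close> terms are gone; the coefficients of
    \<open>l\<close>, \<open>U \<bullet> L A\<close> and \<open>U \<bullet> L A'\<close> agree
    separately.\<close>
  have "2 * (q2 * (l * p) + 2 * q1 * (2 * l * (A \<bullet> U) - U \<bullet> L A) + q * (2 * l * (A' \<bullet> U) - U \<bullet> L A'))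
       + 3 * (q1 * (U \<bullet> L A) + q * (l * (A \<bullet> A))) + q * (U \<bullet> L A')
     = q * (2 * l * (A' \<bullet> U) - U \<bullet> L A' - q * (A \<bullet> A) * (l * p)
         - 2 * q * (A \<bullet> U) * (2 * l * (A \<bullet> U) - U \<bullet> L A)
         + 4 * q\<^sup>2 * (A \<bullet> U)\<^sup>2 * (l * p) - 2 * q * (A' \<bullet> U) * (l * p))"
    using pq unfolding q1 q2 by algebra
  with B1 B2 show ?thesis
    by (simp add: inner_add_left inner_add_right inner_diff_left UL AL AU A'U algebra_simps)
qed

section \<open>From the given definitions to the algebraic form\<close>

lemma speed_squared: "(speed \<gamma> t)\<^sup>2 = velocity \<gamma> t \<bullet> velocity \<gamma> t"
  by (simp add: speed_def)

lemma mercator_W_eq: "mercator_W \<gamma> t = inv_sq (velocity \<gamma> t) *\<^sub>R velocity \<gamma> t"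
  by (simp add: mercator_W_def speed_squared inv_sq_def inverse_eq_divide)

lemma mercator_C_eq:
  fixes \<gamma> :: "real \<Rightarrow> real^'n"
  defines "U \<equiv> velocity \<gamma>" and "A \<equiv> acceleration \<gamma>" and "A' \<equiv> ddt (acceleration \<gamma>)"
  defines "q \<equiv> \<lambda>t. inv_sq (U t)"
  shows "mercator_C \<gamma> t = q t *\<^sub>R (A' t - (q t * (A t \<bullet> A t)) *\<^sub>R U t
      - (2 * q t * (A t \<bullet> U t)) *\<^sub>R A t + (4 * (q t)\<^sup>2 * (A t \<bullet> U t)\<^sup>2) *\<^sub>R U t
      - (2 * q t * (A' t \<bullet> U t)) *\<^sub>R U t)"
proof -
  \<comment> \<open>Where the speed vanishes, all these terms are 0 by the convention
    \<open>1 / 0 = 0\<close>, so the equations hold for every \<open>t\<close>.\<close>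
  have 2: "1 / (speed \<gamma> t)\<^sup>2 = q t" and 4: "1 / (speed \<gamma> t) ^ 4 = (q t)\<^sup>2"
    using speed_squared[of \<gamma> t] power_mult[of "speed \<gamma> t" 2 2]
    by (simp_all add: q_def U_def inv_sq_def inverse_eq_divide power_one_over)
  have "x / (speed \<gamma> t)\<^sup>2 = q t * x" "x / (speed \<gamma> t) ^ 4 = (q t)\<^sup>2 * x" for x
    using 2 4 by (simp_all add: field_simps flip: 2 4)
  then show ?thesis
    by (simp add: mercator_C_def Let_def U_def A_def A'_def power2_norm_eq_inner mult_ac)
qed

text \<open>Derivatives up to \<open>A'\<close> are provided here; that of \<open>mercator_C\<close>
  will come from the Mercator equation instead of a fourth derivative of the curve.\<close>

lemma smooth_curve_derivatives:
  assumes "smooth_curve_on I \<gamma>" "t \<in> I"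
  shows "(\<gamma> has_vector_derivative velocity \<gamma> t) (at t)"
    and "(velocity \<gamma> has_vector_derivative acceleration \<gamma> t) (at t)"
    and "(acceleration \<gamma> has_vector_derivative ddt (acceleration \<gamma>) t) (at t)"
proof -
  have *: "((ddt ^^ k) \<gamma> has_vector_derivative (ddt ^^ Suc k) \<gamma> t) (at t)" for k
    using assms by (simp add: smooth_curve_on_def ddt_def vector_derivative_works)
  show "(\<gamma> has_vector_derivative velocity \<gamma> t) (at t)"
    using *[of 0] by (simp add: velocity_def)
  show "(velocity \<gamma> has_vector_derivative acceleration \<gamma> t) (at t)"
    using *[of 1] by (simp add: velocity_def acceleration_def)
  show "(acceleration \<gamma> has_vector_derivative ddt (acceleration \<gamma>) t) (at t)"
    using *[of 2] by (simp add: velocity_def acceleration_def numeral_2_eq_2)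
qed

section \<open>Constancy of \<open>F\<close> along conformal Mercator curves\<close>

theorem proposition3p1:
  fixes \<gamma> :: "real \<Rightarrow> real^'n" and I :: "real set" and V :: "real^'n \<Rightarrow> real^'n"
  assumes "open I" and "is_interval I"
    and "smooth_curve_on I \<gamma>"
    and "\<forall>t\<in>I. velocity \<gamma> t \<noteq> 0"
    and "conformal_killing V"
    and "conformal_mercator_on I \<gamma>"
  shows "mercator_F V \<gamma> constant_on I"
proof -
  from \<open>conformal_killing V\<close> obtain T R a S
    where skew: "\<And>i j. R $ i $ j = - R $ j $ i" and V: "V = conformal_field T R a S"
    unfolding conformal_killing_def conformal_field_def fun_eq_iff by blast
  define U where "U = velocity \<gamma>"
  define A where "A = acceleration \<gamma>"
  define A' where "A' = ddt A"
  define q where "q = (\<lambda>t. inv_sq (U t))"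
  define q1 where "q1 = (\<lambda>t. inv_sq1 (U t) (A t))"
  define q2 where "q2 = (\<lambda>t. inv_sq2 (U t) (A t) (A' t))"
  define W1 where "W1 = (\<lambda>t. q1 t *\<^sub>R U t + q t *\<^sub>R A t)"
  define W2 where "W2 = (\<lambda>t. q2 t *\<^sub>R U t + (2 * q1 t) *\<^sub>R A t + q t *\<^sub>R A' t)"
  define L where "L = (\<lambda>t. conformal_diff R a S (\<gamma> t))"
  define v1 where "v1 = (\<lambda>t. L t (U t))"
  define v2 where "v2 = (\<lambda>t. L t (A t) + conformal_diff2 S (U t) (U t))"
  define v3 where "v3 = (\<lambda>t. L t (A' t) + 3 *\<^sub>R conformal_diff2 S (U t) (A t))"
  let ?W = "mercator_W \<gamma>" and ?C = "mercator_C \<gamma>"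
  \<comment> \<open>\<open>F\<close> with its outer derivative expanded: the product rule yields a
    second copy of \<open>\<langle>W',V'\<rangle>\<close>, hence the factor 2.\<close>
  define G where "G = (\<lambda>t. 2 * (W1 t \<bullet> v1 t) + ?W t \<bullet> v2 t - ?C t \<bullet> V (\<gamma> t))"
  have W_eq: "?W = (\<lambda>t. q t *\<^sub>R U t)"
    by (simp add: mercator_W_eq q_def U_def fun_eq_iff)
  have U0: "U t \<noteq> 0" if "t \<in> I" for t
    using assms(4) that by (simp add: U_def)
  note D = smooth_curve_derivatives[OF assms(3), folded U_def A_def, folded A'_def]
  have dq: "(q has_vector_derivative q1 t) (at t)" "(q1 has_vector_derivative q2 t) (at t)"
    if "t \<in> I" for t
    unfolding q_def q1_def q2_def
    using has_vector_derivative_inv_sq has_vector_derivative_inv_sq1 D[OF that] U0[OF that]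
    by blast+
  have dW: "(?W has_vector_derivative W1 t) (at t)" if "t \<in> I" for t
    using has_vector_derivative_scaleR_vec[OF dq(1)[OF that] D(2)[OF that]]
    unfolding W_eq W1_def by (simp add: add.commute)
  have dW1: "(W1 has_vector_derivative W2 t) (at t)" if "t \<in> I" for t
  proof -
    have "q1 t *\<^sub>R A t + q2 t *\<^sub>R U t + (q t *\<^sub>R A' t + q1 t *\<^sub>R A t) = W2 t"
      by (simp add: W2_def vec_eq_iff)
    then show ?thesis
      using has_vector_derivative_add[OF
        has_vector_derivative_scaleR_vec[OF dq(2)[OF that] D(2)[OF that]]
        has_vector_derivative_scaleR_vec[OF dq(1)[OF that] D(3)[OF that]]]
      by (simp add: W1_def)
  qed
  have dV: "((V \<circ> \<gamma>) has_vector_derivative v1 t) (at t)" if "t \<in> I" for t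
    using has_vector_derivative_conformal_field[OF D(1)[OF that]]
    by (simp add: V v1_def L_def o_def)
  have dv1: "(v1 has_vector_derivative v2 t) (at t)" if "t \<in> I" for t
    using has_vector_derivative_conformal_diff[OF D(1)[OF that] D(2)[OF that]]
    by (simp add: v1_def v2_def L_def)
  have dv2: "(v2 has_vector_derivative v3 t) (at t)" if "t \<in> I" for t
  proof -
    \<comment> \<open>The factor 3 in \<open>v3\<close>: one copy comes from the moving base point
      of \<open>L\<close>, two from differentiating \<open>conformal_diff2 S (U t) (U t)\<close>,
      and symmetry merges them.\<close>
    have v3_eq: "v3 t = conformal_diff R a S (\<gamma> t) (A' t) + conformal_diff2 S (U t) (A t)
        + (conformal_diff2 S (A t) (U t) + conformal_diff2 S (U t) (A t))"
      by (simp add: v3_def L_def conformal_diff2_commute[of S "A t"] vec_eq_iff)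
    show ?thesis
      unfolding v2_def L_def v3_eq
      by (intro has_vector_derivative_add has_vector_derivative_conformal_diff
          has_vector_derivative_conformal_diff2 D that)
  qed
  have F_eq: "mercator_F V \<gamma> t = G t" if "t \<in> I" for t
  proof -
    have "ddt (\<lambda>s. ?W s \<bullet> ddt (V \<circ> \<gamma>) s) t = ?W t \<bullet> v2 t + W1 t \<bullet> v1 t"
      using ddt_eq_on_open[OF \<open>open I\<close> that _ has_vector_derivative_inner[OF dW dv1], OF _ that that]
        ddt_eqI[OF dV] by auto
    then show ?thesis
      using that by (simp add: mercator_F_def G_def Let_def ddt_eqI[OF dW] ddt_eqI[OF dV])
  qed
  have dG: "(G has_vector_derivative 0) (at t)" if "t \<in> I" for t
  proof -
    have dC: "(?C has_vector_derivative 0) (at t)"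
      using assms(6) that by (simp add: conformal_mercator_on_def)
    have sym: "y \<bullet> L t z + z \<bullet> L t y = 2 * (a - 2 * (S \<bullet> \<gamma> t)) * (y \<bullet> z)" for y z
      using conformal_diff_symmetric_part[OF skew] by (simp add: L_def)
    have "2 * (W2 t \<bullet> v1 t) + 3 * (W1 t \<bullet> v2 t) + ?W t \<bullet> v3 t = ?C t \<bullet> v1 t"
      using conformal_mercator_identity[OF sym U0[OF that], of "A t" "A' t" S]
      unfolding W_eq mercator_C_eq W1_def W2_def v1_def v2_def v3_def
      by (simp only: q_def q1_def q2_def U_def A_def A'_def)
    \<comment> \<open>Two copies of \<open>W1 t \<bullet> v2 t\<close> from the first summand and
      one from the second give the coefficient 3 above; the term
      \<open>0 \<bullet> V (\<gamma> t)\<close> is where the Mercator equation enters.\<close>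
    moreover have "(G has_vector_derivative 2 * (W1 t \<bullet> v2 t + W2 t \<bullet> v1 t)
        + (?W t \<bullet> v3 t + W1 t \<bullet> v2 t) - (?C t \<bullet> v1 t + 0 \<bullet> V (\<gamma> t))) (at t)"
      unfolding G_def
      by (intro has_vector_derivative_diff has_vector_derivative_add has_vector_derivative_inner
          has_vector_derivative_mult_right dW dW1 dv1 dv2 dC dV[unfolded o_def] that)
    ultimately show ?thesis by (simp add: algebra_simps)
  qed
  have "\<exists>c. \<forall>t\<in>I. G t = c"
    using has_vector_derivative_zero_constant[of I G] dG assms(2)
      has_vector_derivative_at_within is_interval_convex by metis
  then show ?thesis
    using F_eq by (auto simp: constant_on_def)
qed

end
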